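(* Let $M\in\mathbb{R}^{2n\times 2n}$ be symmetric positive-definite with symplectic eigenvalues $d_1\le\dots\le d_n$ and let $1\le k\le n$. The set of all global minimizers of the problem $\min_{X\in\mathbb{R}^{2n\times 2k}} \mathrm{tr}(X^TMX)$ subject to $X^TJ_{2n}X=J_{2k}$ is the union of all sets $X_{1:k}\,\mathrm{OrSp}(2k)=\{X_{1:k}K: K\in\mathrm{OrSp}(2k)\}$, where $X_{1:k}$ ranges over the matrices in $\mathrm{Sp}(2k,2n)$ whose columns form a normalized symplectic eigenvector set of $M$ associated with the symplectic eigenvalues $d_1,\dots,d_k$.
   Context: Let $J_{2n}=\begin{bmatrix}0&I_n\\-I_n&0\end{bmatrix}$. $\mathrm{Sp}(2k,2n)=\{X\in\mathbb{R}^{2n\times 2k}: X^TJ_{2n}X=J_{2k}\}$, $\mathrm{Sp}(2k)=\mathrm{Sp}(2k,2k)$, and $\mathrm{OrSp}(2k)$ is the set of matrices in $\mathrm{Sp}(2k)$ that are also orthogonal. Symplectic eigenvalues: by Williamson's theorem there is $S\in\mathrm{Sp}(2n)$ with $S^TMS=\mathrm{diag}(D,D)$, $D=\mathrm{diag}(d_1,\dots,d_n)$, $0<d_1\le\dots\le d_n$; the $d_i$ (uniquely determined by $M$) are the symplectic eigenvalues of $M$, listed with multiplicity in non-decreasing order. Normalized symplectic eigenvector set: the columns of $X\in\mathbb{R}^{2n\times 2k}$ form a normalized symplectic eigenvector set of $M$ associated with the symplectic eigenvalues $\lambda_1,\dots,\lambda_k$ if $X\in\mathrm{Sp}(2k,2n)$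 and $MX=J_{2n}X\begin{bmatrix}0&-\Lambda\\\Lambda&0\end{bmatrix}$ with $\Lambda=\mathrm{diag}(\lambda_1,\dots,\lambda_k)$. *)

theory Defs
  imports "Jordan_Normal_Form.Matrix"
begin

definition mat_trace :: "real mat \<Rightarrow> real" where
  "mat_trace A = (\<Sum>i<dim_row A. A $$ (i, i))"

definition sym_pos_def_mat :: "nat \<Rightarrow> real mat \<Rightarrow> bool" where
  "sym_pos_def_mat m A \<longleftrightarrow> A \<in> carrier_mat m m \<and> transpose_mat A = A \<and>
     (\<forall>v \<in> carrier_vec m. v \<noteq> 0\<^sub>v m \<longrightarrow> v \<bullet> (A *\<^sub>v v) > 0)"

(* J_mat n is the 2n x 2n matrix J_{2n}; likewise the parameters of Sp and OrSp below are the
   half-dimensions: Sp k n is Sp(2k,2n), a set of 2n x 2k matrices, and OrSp k is OrSp(2k). *)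
definition J_mat :: "nat \<Rightarrow> real mat" where
  "J_mat n = four_block_mat (0\<^sub>m n n) (1\<^sub>m n) (- 1\<^sub>m n) (0\<^sub>m n n)"

definition Sp :: "nat \<Rightarrow> nat \<Rightarrow> real mat set" where
  "Sp k n = {X \<in> carrier_mat (2 * n) (2 * k). transpose_mat X * J_mat n * X = J_mat k}"

(* The library predicate orthogonal_mat only requires the columns to be pairwise orthogonal and
   nonzero, hence the explicit orthonormality condition. *)
definition OrSp :: "nat \<Rightarrow> real mat set" where
  "OrSp k = {K \<in> Sp k k. transpose_mat K * K = 1\<^sub>m (2 * k)}"

(* d_1, ..., d_n are represented as d 0, ..., d (n - 1); values d i with i >= n are irrelevant. *)
definition symplectic_eigenvalues :: "nat \<Rightarrow> real mat \<Rightarrow> (nat \<Rightarrow> real) \<Rightarrow> bool" where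
  "symplectic_eigenvalues n M d \<longleftrightarrow>
     (\<forall>i<n. 0 < d i) \<and> mono_on {..<n} d \<and>
     (\<exists>S \<in> Sp n n. transpose_mat S * M * S =
        four_block_mat (mat_diag n d) (0\<^sub>m n n) (0\<^sub>m n n) (mat_diag n d))"

definition normalized_symplectic_eigenvector_set ::
  "nat \<Rightarrow> nat \<Rightarrow> real mat \<Rightarrow> (nat \<Rightarrow> real) \<Rightarrow> real mat \<Rightarrow> bool" where
  "normalized_symplectic_eigenvector_set n k M l X \<longleftrightarrow>
     X \<in> Sp k n \<and>
     M * X = J_mat n * X *
       four_block_mat (0\<^sub>m k k) (- mat_diag k l) (mat_diag k l) (0\<^sub>m k k)"

end

(* With S^T M S = diag(D, D) and Y = S^-1 X, it suffices to treat M = diag(D, D). Reading R^2n as C^n,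
   split Y = [P Q; R S] into its complex linear part U = (P + S) + i (R - Q) and its antilinear part
   V = (P - S) + i (R + Q). Right multiplication by OrSp(2k) acts on U as right multiplication by an
   arbitrary unitary matrix, so by an LQ decomposition U may be assumed lower triangular. Then the
   j-th column of U only involves weights d_i >= d_j, while the symplectic condition on the columns
   j and k + j of Y gives |U_j|^2 - |V_j|^2 = 4; hence these two columns contribute at least 2 d_j to
   the trace. Equality forces V = 0 and U_ij = 0 unless d_i = d_j, which is the eigenvector equation. *)
theory Submission
  imports Defs "Jordan_Normal_Form.Determinant"
begin

section \<open>Unitary triangularization of a complex matrix\<close>

text \<open>The \<open>k - 1\<close> homogeneous equations in \<open>k\<close> unknowns, padded by a
  zero row, form a singular square matrix; a nonzero kernel vector is then scaled to Euclidean norm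
  1.\<close>

lemma underdetermined_unit_solution:
  fixes c :: "nat \<Rightarrow> nat \<Rightarrow> complex"
  assumes "0 < k"
  obtains x where "(\<Sum>l<k. cnj (x l) * x l) = 1" and "\<And>i. i < k - 1 \<Longrightarrow> (\<Sum>l<k. c i l * x l) = 0"
proof -
  define A where "A = mat\<^sub>r k k (\<lambda>i. if i = k - 1 then 0\<^sub>v k else vec k (c i))"
  have A: "A \<in> carrier_mat k k" by (simp add: A_def)
  have "det A = 0" unfolding A_def by (rule det_row_0) (use assms in auto)
  then obtain v where v: "v \<in> carrier_vec k" "v \<noteq> 0\<^sub>v k" "A *\<^sub>v v = 0\<^sub>v k"
    using det_0_iff_vec_prod_zero_field[OF A] by auto
  have eqs: "(\<Sum>l<k. c i l * v $ l) = 0" if "i < k - 1" for i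
  proof -
    have "(A *\<^sub>v v) $ i = 0" using that v(3) by simp
    then show ?thesis
      using that v(1) by (simp add: A_def scalar_prod_def atLeast0LessThan)
  qed
  define s where "s = (\<Sum>l<k. (cmod (v $ l))\<^sup>2)"
  have "\<exists>l<k. v $ l \<noteq> 0"
  proof (rule ccontr)
    assume "\<not> (\<exists>l<k. v $ l \<noteq> 0)"
    then have "v = 0\<^sub>v k" using v(1) by (intro eq_vecI) auto
    with v(2) show False by simp
  qed
  then obtain l where "l < k" "v $ l \<noteq> 0" by blast
  then have "s > 0" unfolding s_def by (intro sum_pos2[of _ l]) simp_all
  define x where "x = (\<lambda>l. v $ l / complex_of_real (sqrt s))"
  have "(\<Sum>l<k. cnj (x l) * x l) = (\<Sum>l<k. complex_of_real ((cmod (v $ l))\<^sup>2 / s))"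
  proof (rule sum.cong[OF refl])
    fix l
    have "cnj (x l) * x l = complex_of_real ((cmod (x l))\<^sup>2)"
      by (simp only: complex_norm_square mult.commute)
    also have "(cmod (x l))\<^sup>2 = (cmod (v $ l))\<^sup>2 / s"
      using \<open>s > 0\<close> by (simp add: x_def norm_divide power_divide)
    finally show "cnj (x l) * x l = complex_of_real ((cmod (v $ l))\<^sup>2 / s)" .
  qed
  also have "\<dots> = complex_of_real (s / s)"
    unfolding s_def by (simp only: of_real_sum sum_divide_distrib)
  finally have 1: "(\<Sum>l<k. cnj (x l) * x l) = 1" using \<open>s > 0\<close> by simp
  have 2: "(\<Sum>l<k. c i l * x l) = 0" if "i < k - 1" for i
  proof -
    have "(\<Sum>l<k. c i l * x l) = (\<Sum>l<k. c i l * v $ l) / complex_of_real (sqrt s)"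
      by (simp add: x_def sum_divide_distrib)
    then show ?thesis using eqs[OF that] by simp
  qed
  show thesis by (rule that[OF 1 2])
qed

text \<open>An LQ decomposition. The columns of \<open>W\<close> are chosen from last to first: column \<open>j\<close> has to be
  orthogonal to \<open>j\<close> rows of \<open>U\<close> and to \<open>k - 1 - j\<close> columns of \<open>W\<close>.\<close>

lemma unitary_lower_triangularization:
  fixes U :: "nat \<Rightarrow> nat \<Rightarrow> complex"
  obtains W where
    "\<And>i j. i < k \<Longrightarrow> j < k \<Longrightarrow> (\<Sum>l<k. cnj (W l i) * W l j) = of_bool (i = j)"
    "\<And>i j. i < j \<Longrightarrow> j < k \<Longrightarrow> (\<Sum>l<k. U i l * W l j) = 0"
proof -
  \<comment> \<open>The induction controls only the last \<open>m\<close> columns of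
    \<open>W\<close>; the other columns are left arbitrary.\<close>
  have "\<exists>W. (\<forall>i j. k - m \<le> i \<and> i < k \<and> k - m \<le> j \<and> j < k \<longrightarrow>
              (\<Sum>l<k. cnj (W l i) * W l j) = of_bool (i = j)) \<and>
            (\<forall>i j. i < j \<and> k - m \<le> j \<and> j < k \<longrightarrow> (\<Sum>l<k. U i l * W l j) = 0)"
    if "m \<le> k" for m
    using that
  proof (induction m)
    case 0
    then show ?case by auto
  next
    case (Suc m)
    then obtain W where "\<forall>i j. k - m \<le> i \<and> i < k \<and> k - m \<le> j \<and> j < k \<longrightarrow>
         (\<Sum>l<k. cnj (W l i) * W l j) = of_bool (i = j)"
      "\<forall>i j. i < j \<and> k - m \<le> j \<and> j < k \<longrightarrow> (\<Sum>l<k. U i l * W l j) = 0"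
      using Suc_leD by blast
    then have W: "\<And>i j. k - m \<le> i \<Longrightarrow> i < k \<Longrightarrow> k - m \<le> j \<Longrightarrow> j < k \<Longrightarrow>
         (\<Sum>l<k. cnj (W l i) * W l j) = of_bool (i = j)"
      and WU: "\<And>i j. i < j \<Longrightarrow> k - m \<le> j \<Longrightarrow> j < k \<Longrightarrow> (\<Sum>l<k. U i l * W l j) = 0"
      by blast+
    define p where "p = k - Suc m"
    have p: "k - m = Suc p" "p < k" using Suc.prems by (auto simp: p_def)
    \<comment> \<open>These are the \<open>k - 1\<close> equations for the new column
      \<open>p\<close>: the indices \<open>i < p\<close> give rows of \<open>U\<close>, and the
      indices from \<open>p\<close> to \<open>k - 2\<close>, shifted by \<open>Suc\<close>, give the
      columns \<open>p + 1, ..., k - 1\<close> of \<open>W\<close> already chosen.\<close>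
    obtain x where x: "(\<Sum>l<k. cnj (x l) * x l) = 1"
      "\<And>i. i < k - 1 \<Longrightarrow> (\<Sum>l<k. (if i < p then U i l else cnj (W l (Suc i))) * x l) = 0"
      using underdetermined_unit_solution[of k "\<lambda>i l. if i < p then U i l else cnj (W l (Suc i))"] p
      by (metis gr_zeroI not_less_zero)
    have xU: "(\<Sum>l<k. U i l * x l) = 0" if "i < p" for i
      using x(2)[of i] that p by simp
    have xW: "(\<Sum>l<k. cnj (W l i) * x l) = 0" if "p < i" "i < k" for i
      using x(2)[of "i - 1"] that by (cases i) simp_all
    have xW': "(\<Sum>l<k. cnj (x l) * W l i) = 0" if "p < i" "i < k" for i
      using arg_cong[OF xW[OF that], of cnj] by (simp add: mult.commute)
    define W' where "W' = (\<lambda>l j. if j = p then x l else W l j)"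
    have "(\<Sum>l<k. cnj (W' l i) * W' l j) = of_bool (i = j)"
      if "p \<le> i" "i < k" "p \<le> j" "j < k" for i j
      using that x(1) xW xW' W[of i j] p by (cases "i = p"; cases "j = p") (simp_all add: W'_def)
    moreover have "(\<Sum>l<k. U i l * W' l j) = 0" if "i < j" "p \<le> j" "j < k" for i j
      using that xU WU[of i j] p by (cases "j = p") (simp_all add: W'_def)
    ultimately show ?case unfolding p_def by blast
  qed
  from this[of k] obtain W where
    "\<forall>i j. i < k \<and> j < k \<longrightarrow> (\<Sum>l<k. cnj (W l i) * W l j) = of_bool (i = j)"
    "\<forall>i j. i < j \<and> j < k \<longrightarrow> (\<Sum>l<k. U i l * W l j) = 0"
    by auto
  then show thesis by (intro that[of W]) blast+
qed

section \<open>Block algebra of symplectic and orthogonal symplectic matrices\<close>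

text \<open>With equations between dimensions as premises, in place of carrier memberships, the
  simplifier can reassociate long products without having to guess dimensions.\<close>

lemma mat_mult_assoc_dim:
  fixes A B C :: "'a::semiring_0 mat"
  assumes "dim_col A = dim_row B" "dim_col B = dim_row C"
  shows "A * B * C = A * (B * C)"
  by (rule assoc_mult_mat[of _ "dim_row A" "dim_row B" _ "dim_row C" _ "dim_col C"])
    (use assms in \<open>auto intro: carrier_matI\<close>)

lemma J_mat_carrier [simp]: "J_mat n \<in> carrier_mat (2 * n) (2 * n)"
  unfolding J_mat_def mult_2 by simp

lemma J_mat_mult_four_block:
  assumes "P \<in> carrier_mat n k" "Q \<in> carrier_mat n k" "R \<in> carrier_mat n k" "S \<in> carrier_mat n k"
  shows "J_mat n * four_block_mat P Q R S = four_block_mat R S (- P) (- Q)"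
  unfolding J_mat_def
  by (subst mult_four_block_mat[of _ n n _ n _ n _ _ k _ k]) (use assms in auto)

text \<open>This puts the symplectic condition into block form. The trace estimate uses only the
  diagonal of the upper right block.\<close>

lemma transpose_mult_J_mult_four_block:
  assumes PQRS: "P \<in> carrier_mat n k" "Q \<in> carrier_mat n k" "R \<in> carrier_mat n k" "S \<in> carrier_mat n k"
  shows "transpose_mat (four_block_mat P Q R S) * J_mat n * four_block_mat P Q R S =
    four_block_mat (P\<^sup>T * R - R\<^sup>T * P) (P\<^sup>T * S - R\<^sup>T * Q) (Q\<^sup>T * R - S\<^sup>T * P) (Q\<^sup>T * S - S\<^sup>T * Q)"
proof -
  have "transpose_mat (four_block_mat P Q R S) * J_mat n * four_block_mat P Q R S =
      transpose_mat (four_block_mat P Q R S) * (J_mat n * four_block_mat P Q R S)"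
    by (rule assoc_mult_mat[of _ "k + k" "n + n" _ "n + n" _ "k + k"])
      (use PQRS in \<open>auto simp: mult_2[symmetric]\<close>)
  also have "\<dots> = four_block_mat P\<^sup>T R\<^sup>T Q\<^sup>T S\<^sup>T * four_block_mat R S (- P) (- Q)"
    using PQRS by (simp add: J_mat_mult_four_block transpose_four_block_mat)
  also have "\<dots> = four_block_mat (P\<^sup>T * R - R\<^sup>T * P) (P\<^sup>T * S - R\<^sup>T * Q)
      (Q\<^sup>T * R - S\<^sup>T * P) (Q\<^sup>T * S - S\<^sup>T * Q)"
    by (subst mult_four_block_mat[of _ k n _ n _ k _ _ k _ k])
      (use PQRS in \<open>auto simp: minus_add_uminus_mat[of _ k k]\<close>)
  finally show ?thesis .
qed

lemma Sp_split:
  assumes "Y \<in> Sp k n"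
  obtains P Q R S where "P \<in> carrier_mat n k" "Q \<in> carrier_mat n k" "R \<in> carrier_mat n k"
    "S \<in> carrier_mat n k" "Y = four_block_mat P Q R S"
proof -
  obtain P Q R S where "split_block Y n k = (P, Q, R, S)" by (metis prod_cases4)
  from split_block[OF this, of n k] assms that show thesis by (auto simp: Sp_def mult_2)
qed

lemma Sp_times_Sp:
  assumes "X \<in> Sp m n" "Y \<in> Sp k m"
  shows "X * Y \<in> Sp k n"
proof -
  have X: "X \<in> carrier_mat (2 * n) (2 * m)" "X\<^sup>T * J_mat n * X = J_mat m"
    and Y: "Y \<in> carrier_mat (2 * m) (2 * k)" "Y\<^sup>T * J_mat m * Y = J_mat k"
    using assms by (auto simp: Sp_def)
  have "(X * Y)\<^sup>T * J_mat n * (X * Y) = Y\<^sup>T * (X\<^sup>T * J_mat n * X) * Y"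
    using X(1) Y(1) carrier_matD[OF J_mat_carrier[of n]]
    by (simp add: transpose_mult[OF X(1) Y(1)] mat_mult_assoc_dim)
  with X Y show ?thesis by (auto simp: Sp_def)
qed

text \<open>The two equations are the real and imaginary parts of the statement that A - iB is
  unitary, and the block matrix is the real form of A - iB acting on x + iy.\<close>

lemma OrSp_four_block:
  assumes AB: "A \<in> carrier_mat k k" "B \<in> carrier_mat k k"
    and 1: "A\<^sup>T * A + B\<^sup>T * B = 1\<^sub>m k" and 0: "A\<^sup>T * B = B\<^sup>T * A"
  shows "four_block_mat A B (- B) A \<in> OrSp k"
proof -
  let ?K = "four_block_mat A B (- B) A"
  have one': "B\<^sup>T * B + A\<^sup>T * A = 1\<^sub>m k" using 1 AB
    by (metis comm_add_mat mult_carrier_mat transpose_carrier_mat)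
  have cancel: "B\<^sup>T * A + - (B\<^sup>T * A) = 0\<^sub>m k k" by (rule eq_matI) (use AB in auto)
  have "?K\<^sup>T * J_mat k * ?K = J_mat k"
    by (subst transpose_mult_J_mult_four_block[OF AB(1,2) uminus_carrier_mat[OF AB(2)] AB(1)],
        unfold J_mat_def, rule cong_four_block_mat) (use AB 0 1 one' in \<open>auto simp: transpose_uminus
          minus_add_uminus_mat[of _ k k] uminus_add_mat[of _ k k, symmetric]\<close>)
  moreover have "?K\<^sup>T * ?K = four_block_mat A\<^sup>T (- B\<^sup>T) B\<^sup>T A\<^sup>T * ?K"
    using AB by (simp add: transpose_four_block_mat[of _ k k _ k _ k] transpose_uminus)
  moreover have "\<dots> = four_block_mat (1\<^sub>m k) (0\<^sub>m k k) (0\<^sub>m k k) (1\<^sub>m k)"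
    by (subst mult_four_block_mat[of _ k k _ k _ k _ _ k _ k])
     (use AB 0 1 one' in \<open>auto simp: cancel intro!: cong_four_block_mat\<close>)
  ultimately show ?thesis using AB by (auto simp: OrSp_def Sp_def mult_2)
qed

text \<open>A left inverse of a square matrix is also a right inverse; inserting K K^T = 1 on both
  sides of J then gives K J K^T = J. This serves to undo a rotation: X = (X K) K^T.\<close>

lemma OrSp_mult_transpose:
  assumes "K \<in> OrSp k"
  shows "K \<in> carrier_mat (2 * k) (2 * k)" "K * K\<^sup>T = 1\<^sub>m (2 * k)" "K\<^sup>T \<in> OrSp k"
proof -
  let ?c = "carrier_mat (2 * k) (2 * k)"
  have K: "K \<in> ?c" "K\<^sup>T * J_mat k * K = J_mat k" "K\<^sup>T * K = 1\<^sub>m (2 * k)"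
    using assms by (auto simp: OrSp_def Sp_def)
  show *: "K * K\<^sup>T = 1\<^sub>m (2 * k)"
    by (rule mat_mult_left_right_inverse[OF _ K(1) K(3)]) (use K(1) in auto)
  have "J_mat k = (K * K\<^sup>T) * J_mat k * (K * K\<^sup>T)"
    by (simp add: * left_mult_one_mat[OF J_mat_carrier] right_mult_one_mat[OF J_mat_carrier])
  also have "\<dots> = K * (K\<^sup>T * J_mat k * K) * K\<^sup>T"
    using K(1) carrier_matD[OF J_mat_carrier[of k]] by (simp add: mat_mult_assoc_dim)
  finally have "K\<^sup>T\<^sup>T * J_mat k * K\<^sup>T = J_mat k" using K(2) by simp
  then show "K\<^sup>T \<in> OrSp k" using K(1) * by (simp add: OrSp_def Sp_def)
  show "K \<in> ?c" by fact
qed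

text \<open>The last conclusion says, in real coordinates, that the complex linear part (P + S) + i
  (R - Q) of \<open>Y * K\<close> vanishes above the diagonal.\<close>

lemma Sp_lower_triangularization:
  assumes "Y \<in> Sp k n" "k \<le> n"
  obtains K P Q R S where "K \<in> OrSp k"
    "P \<in> carrier_mat n k" "Q \<in> carrier_mat n k" "R \<in> carrier_mat n k" "S \<in> carrier_mat n k"
    "Y * K = four_block_mat P Q R S"
    "\<And>i j. i < j \<Longrightarrow> j < k \<Longrightarrow> P $$ (i, j) + S $$ (i, j) = 0 \<and> R $$ (i, j) = Q $$ (i, j)"
proof -
  obtain P Q R S where c: "P \<in> carrier_mat n k" "Q \<in> carrier_mat n k" "R \<in> carrier_mat n k"
    "S \<in> carrier_mat n k" and Y: "Y = four_block_mat P Q R S"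
    using assms(1) by (rule Sp_split)
  define U where
    "U = (\<lambda>i l. Complex (P $$ (i, l) + S $$ (i, l)) (R $$ (i, l) - Q $$ (i, l)))"
  obtain W where W:
    "\<And>i j. i < k \<Longrightarrow> j < k \<Longrightarrow> (\<Sum>l<k. cnj (W l i) * W l j) = of_bool (i = j)"
    "\<And>i j. i < j \<Longrightarrow> j < k \<Longrightarrow> (\<Sum>l<k. U i l * W l j) = 0"
    using unitary_lower_triangularization[of k U] by blast
  \<comment> \<open>The minus sign makes W = A - iB, the convention of
    \<open>OrSp_four_block\<close>.\<close>
  define A B where "A = mat k k (\<lambda>(l, j). Re (W l j))" and "B = mat k k (\<lambda>(l, j). - Im (W l j))"
  have AB: "A \<in> carrier_mat k k" "B \<in> carrier_mat k k" by (auto simp: A_def B_def)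
  have one: "A\<^sup>T * A + B\<^sup>T * B = 1\<^sub>m k"
  proof (rule eq_matI)
    fix i j assume ij: "i < dim_row (1\<^sub>m k :: real mat)" "j < dim_col (1\<^sub>m k :: real mat)"
    then show "(A\<^sup>T * A + B\<^sup>T * B) $$ (i, j) = 1\<^sub>m k $$ (i, j)"
      using arg_cong[OF W(1)[of i j], of Re]
      by (simp add: A_def B_def scalar_prod_def atLeast0LessThan sum.distrib sum_subtractf)
  qed (use AB in auto)
  have zero: "A\<^sup>T * B = B\<^sup>T * A"
  proof (rule eq_matI)
    fix i j assume ij: "i < dim_row (B\<^sup>T * A)" "j < dim_col (B\<^sup>T * A)"
    then show "(A\<^sup>T * B) $$ (i, j) = (B\<^sup>T * A) $$ (i, j)"
      using AB arg_cong[OF W(1)[of i j], of Im]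
      by (cases "i = j") (simp_all add: mult.commute A_def B_def scalar_prod_def atLeast0LessThan sum.distrib sum_subtractf sum_negf)
  qed (use AB in auto)
  have K: "four_block_mat A B (- B) A \<in> OrSp k" by (rule OrSp_four_block[OF AB one zero])
  have YK: "Y * four_block_mat A B (- B) A =
      four_block_mat (P * A - Q * B) (P * B + Q * A) (R * A - S * B) (R * B + S * A)"
    unfolding Y by (subst mult_four_block_mat[of _ n k _ k _ n _ _ k _ k])
      (use c AB in \<open>auto simp: minus_add_uminus_mat[of _ n k]\<close>)
  show thesis
  proof (rule that[OF K _ _ _ _ YK])
    fix i j assume ij: "i < j" "j < k"
    then have "i < n" using assms(2) by simp
    \<comment> \<open>The complex linear part of the rotated matrix is UW, so the two claims are the
      real and imaginary parts of (UW)_ij = 0.\<close>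
    then show "(P * A - Q * B) $$ (i, j) + (R * B + S * A) $$ (i, j) = 0 \<and>
        (R * A - S * B) $$ (i, j) = (P * B + Q * A) $$ (i, j)"
      using ij c arg_cong[OF W(2)[OF ij], of Re] arg_cong[OF W(2)[OF ij], of Im]
      by (simp add: A_def B_def U_def scalar_prod_def atLeast0LessThan sum.distrib sum_subtractf
          sum_negf algebra_simps)
  qed (use c AB in auto)
qed

section \<open>The inequality for one pair of columns\<close>

text \<open>With \<open>g i\<close> and \<open>f i\<close> the squared moduli of the i-th entries of
  the linear and antilinear parts, g + f is twice the sum of the four squares and g - f = 4 (p s - r
  q). Hence 2 T - 4 d_j is the sum of (d_i - d_j) g_i + (d_i + d_j) f_i. A negative factor d_i - d_j
  can occur only for i < j, where \<open>tri\<close> makes g_i zero.\<close>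

lemma weighted_symplectic_pair_bound:
  fixes p q r s d :: "nat \<Rightarrow> real"
  assumes d: "\<And>i. i < n \<Longrightarrow> 0 < d i" "mono_on {..<n} d" and j: "j < n"
    and symp: "(\<Sum>i<n. p i * s i - r i * q i) = 1"
    and tri: "\<And>i. i < j \<Longrightarrow> p i + s i = 0 \<and> r i = q i"
  defines "T \<equiv> \<Sum>i<n. d i * ((p i)\<^sup>2 + (q i)\<^sup>2 + (r i)\<^sup>2 + (s i)\<^sup>2)"
  shows "2 * d j \<le> T"
    and "T = 2 * d j \<Longrightarrow> i < n \<Longrightarrow>
      s i = p i \<and> r i = - q i \<and> d i * p i = d j * p i \<and> d i * q i = d j * q i"
proof -
  define g f where "g = (\<lambda>i. (p i + s i)\<^sup>2 + (q i - r i)\<^sup>2)"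
    and "f = (\<lambda>i. (p i - s i)\<^sup>2 + (q i + r i)\<^sup>2)"
  have "2 * T - 4 * d j = 2 * T - 4 * d j * (\<Sum>i<n. p i * s i - r i * q i)"
    using symp by simp
  also have "\<dots> = (\<Sum>i<n. (d i - d j) * g i + (d i + d j) * f i)"
    unfolding T_def g_def f_def sum_distrib_left sum_subtractf[symmetric]
    by (rule sum.cong) (auto simp: power2_eq_square algebra_simps)
  finally have eq: "2 * T - 4 * d j = (\<Sum>i<n. (d i - d j) * g i + (d i + d j) * f i)" .
  have g: "0 \<le> (d i - d j) * g i" if "i < n" for i
  proof (cases "i < j")
    case True
    then show ?thesis using tri by (simp add: g_def)
  next
    case False
    then have "d j \<le> d i" using d(2) j that by (auto simp: mono_on_def)
    then show ?thesis by (simp add: g_def)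
  qed
  have f: "0 \<le> (d i + d j) * f i" if "i < n" for i
    using d(1)[OF that] d(1)[OF j] by (simp add: f_def)
  have "0 \<le> (\<Sum>i<n. (d i - d j) * g i + (d i + d j) * f i)"
    using g f by (intro sum_nonneg add_nonneg_nonneg) auto
  then show "2 * d j \<le> T" using eq by simp
  assume T: "T = 2 * d j" and i: "i < n"
  have "\<forall>i\<in>{..<n}. (d i - d j) * g i + (d i + d j) * f i = 0"
    using eq T g f by (subst sum_nonneg_eq_0_iff[symmetric]) auto
  then have "(d i - d j) * g i = 0" "(d i + d j) * f i = 0"
    using g[OF i] f[OF i] i by (metis add_nonneg_eq_0_iff lessThan_iff)+
  moreover have "d i + d j > 0" using d(1)[OF i] d(1)[OF j] by simp
  \<comment> \<open>From \<open>f i = 0\<close> follow s = p and r = -q, so that g = 4 (p^2 + q^2).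
    If the weights differ, then p = q = 0, and the weight equations hold in either case.\<close>
  ultimately have "d i = d j \<or> g i = 0" "f i = 0" by auto
  then show "s i = p i \<and> r i = - q i \<and> d i * p i = d j * p i \<and> d i * q i = d j * q i"
    by (auto simp: f_def g_def sum_power2_eq_zero_iff)
qed

section \<open>Traces and products of block matrices with diagonal blocks\<close>

lemma mat_trace_mult_comm:
  assumes "A \<in> carrier_mat m l" "B \<in> carrier_mat l m"
  shows "mat_trace (A * B) = mat_trace (B * A)"
  using assms sum.swap[of "\<lambda>i j. A $$ (i, j) * B $$ (j, i)" "{..<l}" "{..<m}"]
  by (simp add: mat_trace_def scalar_prod_def atLeast0LessThan mult.commute)

text \<open>Cyclicity of the trace brings K next to K^T. This is used both to pass to the triangular
  form and to see that all of X1 OrSp(2k) has the same objective value.\<close>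

lemma mat_trace_orthogonal_conj:
  assumes "X \<in> carrier_mat m (2 * k)" "M \<in> carrier_mat m m" "K \<in> OrSp k"
  shows "mat_trace ((X * K)\<^sup>T * M * (X * K)) = mat_trace (X\<^sup>T * M * X)"
proof -
  note K = OrSp_mult_transpose[OF assms(3)]
  have N: "X\<^sup>T * M * X \<in> carrier_mat (2 * k) (2 * k)" using assms by simp
  have "(X * K)\<^sup>T * M * (X * K) = K\<^sup>T * ((X\<^sup>T * M * X) * K)"
    using assms(1,2) K(1) by (simp add: transpose_mult[OF assms(1) K(1)] mat_mult_assoc_dim)
  also have "mat_trace \<dots> = mat_trace (((X\<^sup>T * M * X) * K) * K\<^sup>T)"
    by (rule mat_trace_mult_comm[of _ "2*k" "2*k"]) (use N K(1) in auto)
  also have "((X\<^sup>T * M * X) * K) * K\<^sup>T = X\<^sup>T * M * X"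
    using K(1,2) by (subst mat_mult_assoc_dim) (use N in \<open>auto simp: right_mult_one_mat[OF N]\<close>)
  finally show ?thesis .
qed

lemma mat_trace_four_block:
  assumes "A \<in> carrier_mat k k" "D \<in> carrier_mat k k"
  shows "mat_trace (four_block_mat A B C D) = mat_trace A + mat_trace D"
proof -
  have "(\<Sum>i<k + k. f i) = (\<Sum>i<k. f i) + (\<Sum>i<k. f (k + i))" for f :: "nat \<Rightarrow> real"
    by (simp add: lessThan_atLeast0 sum.atLeastLessThan_concat[of 0 k "k + k", symmetric]
        sum.shift_bounds_nat_ivl[of f 0 k k, simplified] add.commute)
  then show ?thesis using assms by (simp add: mat_trace_def)
qed

lemma mat_trace_transpose_diag:
  assumes "A \<in> carrier_mat n k"
  shows "mat_trace (A\<^sup>T * (mat_diag n d * A)) = (\<Sum>j<k. \<Sum>i<n. d i * (A $$ (i, j))\<^sup>2)"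
  using assms by (simp add: mat_trace_def mat_diag_mult_left scalar_prod_def atLeast0LessThan
      power2_eq_square mult_ac)

abbreviation double_diag :: "nat \<Rightarrow> (nat \<Rightarrow> real) \<Rightarrow> real mat" where
  "double_diag n d \<equiv> four_block_mat (mat_diag n d) (0\<^sub>m n n) (0\<^sub>m n n) (mat_diag n d)"

lemma double_diag_mult_four_block:
  assumes "P \<in> carrier_mat n k" "Q \<in> carrier_mat n k" "R \<in> carrier_mat n k" "S \<in> carrier_mat n k"
  shows "double_diag n d * four_block_mat P Q R S =
    four_block_mat (mat_diag n d * P) (mat_diag n d * Q) (mat_diag n d * R) (mat_diag n d * S)"
  by (subst mult_four_block_mat[of _ n n _ n _ n _ _ k _ k])
    (use assms in \<open>auto intro!: cong_four_block_mat left_add_zero_mat right_add_zero_mat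
      mult_carrier_mat simp: left_mult_zero_mat[of _ n k]\<close>)

lemma mat_trace_double_diag_four_block:
  assumes c: "P \<in> carrier_mat n k" "Q \<in> carrier_mat n k" "R \<in> carrier_mat n k" "S \<in> carrier_mat n k"
  shows "mat_trace ((four_block_mat P Q R S)\<^sup>T * double_diag n d * four_block_mat P Q R S) =
    (\<Sum>j<k. \<Sum>i<n. d i * ((P $$ (i, j))\<^sup>2 + (Q $$ (i, j))\<^sup>2 + (R $$ (i, j))\<^sup>2 + (S $$ (i, j))\<^sup>2))"
proof -
  let ?D = "mat_diag n d"
  have D: "?D * A \<in> carrier_mat n k" if "A \<in> carrier_mat n k" for A
    using that by (rule mult_carrier_mat[OF mat_diag_dim])
  have "(four_block_mat P Q R S)\<^sup>T * double_diag n d * four_block_mat P Q R S =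
      (four_block_mat P Q R S)\<^sup>T * (double_diag n d * four_block_mat P Q R S)"
    by (rule assoc_mult_mat[of _ "k + k" "n + n" _ "n + n" _ "k + k"]) (use c in auto)
  also have "\<dots> = four_block_mat P\<^sup>T R\<^sup>T Q\<^sup>T S\<^sup>T * four_block_mat (?D * P) (?D * Q) (?D * R) (?D * S)"
    using c by (simp add: double_diag_mult_four_block transpose_four_block_mat)
  also have "\<dots> = four_block_mat (P\<^sup>T * (?D * P) + R\<^sup>T * (?D * R)) (P\<^sup>T * (?D * Q) + R\<^sup>T * (?D * S))
      (Q\<^sup>T * (?D * P) + S\<^sup>T * (?D * R)) (Q\<^sup>T * (?D * Q) + S\<^sup>T * (?D * S))"
    by (rule mult_four_block_mat[of _ k n _ n _ k _ _ k _ k]) (use c D in auto)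
  finally have eq: "(four_block_mat P Q R S)\<^sup>T * double_diag n d * four_block_mat P Q R S = \<dots>" .
  have add: "mat_trace (A + B) = mat_trace A + mat_trace B"
    if "A \<in> carrier_mat k k" "B \<in> carrier_mat k k" for A B
    using that by (simp add: mat_trace_def sum.distrib)
  have C: "A\<^sup>T * (?D * A) \<in> carrier_mat k k" if "A \<in> carrier_mat n k" for A
    using that by (intro mult_carrier_mat[of _ k n] mult_carrier_mat[of _ n n]) auto
  show ?thesis
    unfolding eq using C c by (simp add: mat_trace_four_block[of _ k] add mat_trace_transpose_diag
      sum.distrib[symmetric] algebra_simps)
qed

text \<open>This is the right factor of the eigenvector equation. It equals -J_{2k} diag(L, L) for L
  = diag(l), so multiplying it by J_{2k} from the left gives diag(L, L).\<close>

abbreviation skew_diag :: "nat \<Rightarrow> (nat \<Rightarrow> real) \<Rightarrow> real mat" where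
  "skew_diag k l \<equiv> four_block_mat (0\<^sub>m k k) (- mat_diag k l) (mat_diag k l) (0\<^sub>m k k)"

lemma four_block_mult_skew_diag:
  assumes "P \<in> carrier_mat n k" "Q \<in> carrier_mat n k" "R \<in> carrier_mat n k" "S \<in> carrier_mat n k"
  shows "four_block_mat P Q R S * skew_diag k l =
    four_block_mat (Q * mat_diag k l) (- (P * mat_diag k l)) (S * mat_diag k l) (- (R * mat_diag k l))"
proof -
  have "A * mat_diag k l \<in> carrier_mat n k" if "A \<in> carrier_mat n k" for A
    using that by (rule mult_carrier_mat[OF _ mat_diag_dim])
  moreover have "dim_row (mat_diag k l) = k"
    by (rule carrier_matD(1)[OF mat_diag_dim])
  ultimately show ?thesis
    by (subst mult_four_block_mat[of _ n k _ k _ n _ _ k _ k])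
      (use assms in \<open>auto intro!: cong_four_block_mat\<close>)
qed

section \<open>The lower bound and its equality case for diag(D, D)\<close>

text \<open>The triangularizing K leaves the trace unchanged, and the trace splits into
  contributions \<open>T j\<close> of the column pairs j, k + j of Y K, each at least 2 d_j. If the
  total is minimal, every pair is in its equality case.\<close>

lemma double_diag_trace_minimum:
  assumes Y: "Y \<in> Sp k n" and kn: "k \<le> n" and d: "\<forall>i<n. 0 < d i" "mono_on {..<n} d"
  obtains K where "K \<in> OrSp k" "2 * (\<Sum>j<k. d j) \<le> mat_trace (Y\<^sup>T * double_diag n d * Y)"
    "mat_trace (Y\<^sup>T * double_diag n d * Y) = 2 * (\<Sum>j<k. d j) \<Longrightarrow>
      double_diag n d * (Y * K) = J_mat n * (Y * K) * skew_diag k d"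
proof -
  let ?D = "double_diag n d"
  obtain K P Q R S where K: "K \<in> OrSp k"
    and c: "P \<in> carrier_mat n k" "Q \<in> carrier_mat n k" "R \<in> carrier_mat n k" "S \<in> carrier_mat n k"
    and YK: "Y * K = four_block_mat P Q R S"
    and tri: "\<And>i j. i < j \<Longrightarrow> j < k \<Longrightarrow> P $$ (i, j) + S $$ (i, j) = 0 \<and> R $$ (i, j) = Q $$ (i, j)"
    using Sp_lower_triangularization[OF Y kn] by blast
  have "Y * K \<in> Sp k n" using Y K by (auto simp: OrSp_def intro: Sp_times_Sp)
  then have "four_block_mat (P\<^sup>T * R - R\<^sup>T * P) (P\<^sup>T * S - R\<^sup>T * Q) (Q\<^sup>T * R - S\<^sup>T * P) (Q\<^sup>T * S - S\<^sup>T * Q)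
      = J_mat k"
    unfolding YK Sp_def using transpose_mult_J_mult_four_block[OF c] by simp
  \<comment> \<open>The entry (j, k + j) pairs the columns j and k + j of Y K, where J_{2k} has the
    value 1.\<close>
  then have J: "four_block_mat (P\<^sup>T * R - R\<^sup>T * P) (P\<^sup>T * S - R\<^sup>T * Q) (Q\<^sup>T * R - S\<^sup>T * P)
      (Q\<^sup>T * S - S\<^sup>T * Q) $$ (j, k + j) = J_mat k $$ (j, k + j)" for j by simp
  have symp: "(\<Sum>i<n. P $$ (i, j) * S $$ (i, j) - R $$ (i, j) * Q $$ (i, j)) = 1" if "j < k" for j
    using J[of j] that c by (simp add: J_mat_def scalar_prod_def atLeast0LessThan sum_subtractf)
  define T where "T j = (\<Sum>i<n. d i *
    ((P $$ (i, j))\<^sup>2 + (Q $$ (i, j))\<^sup>2 + (R $$ (i, j))\<^sup>2 + (S $$ (i, j))\<^sup>2))" for j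
  have tr: "mat_trace (Y\<^sup>T * ?D * Y) = (\<Sum>j<k. T j)"
  proof -
    have "mat_trace (Y\<^sup>T * ?D * Y) = mat_trace ((Y * K)\<^sup>T * ?D * (Y * K))"
      by (rule mat_trace_orthogonal_conj[of _ "2 * n", symmetric])
        (use Y K in \<open>auto simp: Sp_def mult_2\<close>)
    then show ?thesis unfolding YK T_def mat_trace_double_diag_four_block[OF c] .
  qed
  note bound = weighted_symplectic_pair_bound[where d = d and n = n and j = j and
      p = "\<lambda>i. P $$ (i, j)" and q = "\<lambda>i. Q $$ (i, j)" and
      r = "\<lambda>i. R $$ (i, j)" and s = "\<lambda>i. S $$ (i, j)" for j, folded T_def]
  have T: "2 * d j \<le> T j" if "j < k" for j
    using that kn d by (intro bound(1) symp tri) auto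
  have le: "2 * (\<Sum>j<k. d j) \<le> mat_trace (Y\<^sup>T * ?D * Y)"
    unfolding tr sum_distrib_left using T by (intro sum_mono) auto
  have "?D * (Y * K) = J_mat n * (Y * K) * skew_diag k d"
    if eq: "mat_trace (Y\<^sup>T * ?D * Y) = 2 * (\<Sum>j<k. d j)"
  proof -
    have "(\<Sum>j<k. T j - 2 * d j) = 0" using eq unfolding tr by (simp add: sum_subtractf sum_distrib_left)
    then have "\<forall>j\<in>{..<k}. T j - 2 * d j = 0" using T by (subst (asm) sum_nonneg_eq_0_iff) auto
    then have *: "S $$ (i, j) = P $$ (i, j) \<and> R $$ (i, j) = - Q $$ (i, j) \<and>
        d i * P $$ (i, j) = d j * P $$ (i, j) \<and> d i * Q $$ (i, j) = d j * Q $$ (i, j)"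
      if "i < n" "j < k" for i j
      using that kn d by (intro bound(2) symp tri) auto
    \<comment> \<open>The antilinear part vanishes, and the weight equations become D P = P L and D
      Q = Q L with L = diag(d_1, ..., d_k). After multiplying out the blocks, these are exactly the
      eigenvector equation.\<close>
    have S: "S = P" and R: "R = - Q" using c * by (auto intro!: eq_matI)
    have DP: "mat_diag n d * P = P * mat_diag k d" and DQ: "mat_diag n d * Q = Q * mat_diag k d"
      using c * by (auto intro!: eq_matI simp: mat_diag_mult_left mat_diag_mult_right mult.commute)
    have J: "J_mat n * four_block_mat P Q (- Q) P = four_block_mat (- Q) P (- P) (- Q)"
      by (rule J_mat_mult_four_block) (use c in auto)
    show ?thesis unfolding YK S R J
      by (subst double_diag_mult_four_block[of _ n k], (use c in auto)[4],
          subst four_block_mult_skew_diag[of _ n k], (use c in auto)[4])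
        (use c carrier_matD[OF mat_diag_dim[of n d]] carrier_matD[OF mat_diag_dim[of k d]]
          in \<open>auto simp: DP DQ\<close>)
  qed
  with K le show thesis by (rule that)
qed

section \<open>Attainment of the bound and transfer to M\<close>

text \<open>Since J^2 = -1, the equation S^T J S = J says that -J S^T J is a left inverse of S. It
  is symplectic because J = (S T)^T J (S T) = T^T J T.\<close>

lemma Sp_inverse:
  assumes "S \<in> Sp n n"
  obtains T where "T \<in> Sp n n" "S * T = 1\<^sub>m (2 * n)" "T * S = 1\<^sub>m (2 * n)"
proof -
  have S: "S \<in> carrier_mat (2 * n) (2 * n)" "S\<^sup>T * J_mat n * S = J_mat n"
    using assms by (auto simp: Sp_def)
  note J = J_mat_carrier[of n] carrier_matD[OF J_mat_carrier[of n]]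
  have "J_mat n * J_mat n = four_block_mat (- 1\<^sub>m n) (0\<^sub>m n n) (- 0\<^sub>m n n) (- 1\<^sub>m n)"
    by (subst (2) J_mat_def) (rule J_mat_mult_four_block[of _ n n]; simp)
  also have "\<dots> = - 1\<^sub>m (2 * n)"
    by (rule eq_matI) auto
  finally have JJ: "J_mat n * J_mat n = - 1\<^sub>m (2 * n)" .
  define T where "T = - (J_mat n * S\<^sup>T * J_mat n)"
  have T: "T \<in> carrier_mat (2 * n) (2 * n)" using S(1) unfolding T_def uminus_carrier_iff_mat
    by (intro mult_carrier_mat[of _ "2 * n" "2 * n"]) simp_all
  have "T * S = - (J_mat n * (S\<^sup>T * J_mat n * S))"
    using S(1) J by (simp add: T_def mat_mult_assoc_dim)
  then have TS: "T * S = 1\<^sub>m (2 * n)" by (simp add: S(2) JJ)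
  have ST: "S * T = 1\<^sub>m (2 * n)" by (rule mat_mult_left_right_inverse[OF T S(1) TS])
  have "J_mat n = (S * T)\<^sup>T * J_mat n * (S * T)" using J by (simp add: ST)
  also have "\<dots> = T\<^sup>T * (S\<^sup>T * J_mat n * S) * T"
    using S(1) T J by (simp add: transpose_mult[OF S(1) T] mat_mult_assoc_dim)
  finally have "T \<in> Sp n n" using T by (simp add: S(2) Sp_def)
  then show thesis using ST TS by (rule that)
qed

text \<open>Multiplying the eigenvector equation by X^T from the left and using X^T J X = J_{2k}
  shows that X^T M X = diag(L, L) with L = diag(l).\<close>

lemma mat_trace_normalized_symplectic_eigenvector_set:
  assumes "M \<in> carrier_mat (2 * n) (2 * n)" "normalized_symplectic_eigenvector_set n k M l X"
  shows "mat_trace (X\<^sup>T * M * X) = 2 * (\<Sum>j<k. l j)"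
proof -
  have X: "X \<in> carrier_mat (2 * n) (2 * k)" "X\<^sup>T * J_mat n * X = J_mat k"
    and eq: "M * X = J_mat n * X * skew_diag k l"
    using assms(2) by (auto simp: normalized_symplectic_eigenvector_set_def Sp_def)
  have L: "dim_row (skew_diag k l) = 2 * k" by (simp add: mat_diag_def)
  have "X\<^sup>T * M * X = X\<^sup>T * (J_mat n * X * skew_diag k l)"
    using X(1) assms(1) by (simp add: mat_mult_assoc_dim eq)
  also have "\<dots> = X\<^sup>T * J_mat n * X * skew_diag k l"
    using X(1) L carrier_matD[OF J_mat_carrier[of n]]
    by (simp add: mat_mult_assoc_dim del: index_mat_four_block)
  also have "\<dots> = four_block_mat (mat_diag k l) (0\<^sub>m k k) (- 0\<^sub>m k k) (- (- mat_diag k l))"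
    unfolding X(2) by (rule J_mat_mult_four_block[of _ k k]) auto
  finally show ?thesis
    by (simp add: mat_trace_four_block[of _ k]) (simp add: mat_trace_def mat_diag_def)
qed

text \<open>The witness has the standard basis vectors e_1, ..., e_k and e_{n+1}, ..., e_{n+k} as
  columns.\<close>

lemma double_diag_trace_attained:
  assumes "k \<le> n"
  obtains Y where "Y \<in> Sp k n" "mat_trace (Y\<^sup>T * double_diag n d * Y) = 2 * (\<Sum>j<k. d j)"
proof -
  define E :: "real mat" where "E = mat n k (\<lambda>(i, j). of_bool (i = j))"
  have E: "E \<in> carrier_mat n k" by (simp add: E_def)
  have EE: "E\<^sup>T * E = 1\<^sub>m k"
  proof (rule eq_matI)
    fix i j assume ij: "i < dim_row (1\<^sub>m k :: real mat)" "j < dim_col (1\<^sub>m k :: real mat)"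
    then have "(E\<^sup>T * E) $$ (i, j) = (\<Sum>l<n. of_bool (l = i) * of_bool (l = j))"
      by (simp add: E_def scalar_prod_def atLeast0LessThan)
    also have "\<dots> = (\<Sum>l<n. if l = i then of_bool (i = j) else 0)"
      by (intro sum.cong) auto
    finally show "(E\<^sup>T * E) $$ (i, j) = 1\<^sub>m k $$ (i, j)"
      using ij assms by simp
  qed (simp_all add: E_def)
  let ?Y = "four_block_mat E (0\<^sub>m n k) (0\<^sub>m n k) E"
  show thesis
  proof (rule that[of ?Y])
    have "?Y\<^sup>T * J_mat n * ?Y = J_mat k"
      unfolding transpose_mult_J_mult_four_block[OF E zero_carrier_mat zero_carrier_mat E]
      by (unfold J_mat_def, rule cong_four_block_mat) (use E EE in auto)
    then show "?Y \<in> Sp k n" using E by (simp add: Sp_def mult_2)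
    have "(\<Sum>i<n. d i * ((E $$ (i, j))\<^sup>2 + (E $$ (i, j))\<^sup>2)) = 2 * d j" if "j < k" for j
    proof -
      have "(\<Sum>i<n. d i * ((E $$ (i, j))\<^sup>2 + (E $$ (i, j))\<^sup>2)) = (\<Sum>i<n. if i = j then 2 * d i else 0)"
        using that by (intro sum.cong) (auto simp: E_def)
      then show ?thesis using that assms by simp
    qed
    then show "mat_trace (?Y\<^sup>T * double_diag n d * ?Y) = 2 * (\<Sum>j<k. d j)"
      unfolding mat_trace_double_diag_four_block[OF E zero_carrier_mat zero_carrier_mat E]
      using assms by (simp add: sum_distrib_left)
  qed
qed

text \<open>The substitution X = S Y, with inverse Y = T X, preserves the symplectic constraint and
  turns the objective for M into the one for diag(D, D).\<close>

lemma symplectic_trace_minimum: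
  assumes M: "M \<in> carrier_mat (2 * n) (2 * n)" and d: "symplectic_eigenvalues n M d" and kn: "k \<le> n"
  shows "X \<in> Sp k n \<Longrightarrow> 2 * (\<Sum>j<k. d j) \<le> mat_trace (X\<^sup>T * M * X)"
    and "X \<in> Sp k n \<Longrightarrow> mat_trace (X\<^sup>T * M * X) = 2 * (\<Sum>j<k. d j) \<Longrightarrow>
      \<exists>K \<in> OrSp k. normalized_symplectic_eigenvector_set n k M d (X * K)"
    and "\<exists>X \<in> Sp k n. mat_trace (X\<^sup>T * M * X) = 2 * (\<Sum>j<k. d j)"
proof -
  obtain S where S: "S \<in> Sp n n" and SMS: "S\<^sup>T * M * S = double_diag n d"
    and pos: "\<forall>i<n. 0 < d i" and mono: "mono_on {..<n} d"
    using d unfolding symplectic_eigenvalues_def by auto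
  obtain T where T: "T \<in> Sp n n" and ST: "S * T = 1\<^sub>m (2 * n)"
    using Sp_inverse[OF S] by blast
  have Sc: "S \<in> carrier_mat (2 * n) (2 * n)" "S\<^sup>T * J_mat n * S = J_mat n"
    and Tc: "T \<in> carrier_mat (2 * n) (2 * n)"
    using S T by (auto simp: Sp_def)
  note Jd = carrier_matD[OF J_mat_carrier[of n]]
  have trace: "mat_trace ((S * Y)\<^sup>T * M * (S * Y)) = mat_trace (Y\<^sup>T * double_diag n d * Y)"
    if "Y \<in> Sp k n" for Y
  proof -
    have Y: "Y \<in> carrier_mat (2 * n) (2 * k)" using that by (simp add: Sp_def)
    have "(S * Y)\<^sup>T * M * (S * Y) = Y\<^sup>T * (S\<^sup>T * M * S) * Y"
      using Sc(1) M Y by (simp add: transpose_mult[OF Sc(1) Y] mat_mult_assoc_dim)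
    then show ?thesis by (simp only: SMS)
  qed
  show "\<exists>X \<in> Sp k n. mat_trace (X\<^sup>T * M * X) = 2 * (\<Sum>j<k. d j)"
    using double_diag_trace_attained[OF kn, of d] trace Sp_times_Sp[OF S] by metis
  assume X: "X \<in> Sp k n"
  define Y where "Y = T * X"
  have Xc: "X \<in> carrier_mat (2 * n) (2 * k)" using X by (simp add: Sp_def)
  have Y: "Y \<in> Sp k n" unfolding Y_def by (rule Sp_times_Sp[OF T X])
  then have Yc: "Y \<in> carrier_mat (2 * n) (2 * k)" by (simp add: Sp_def)
  have "S * Y = S * T * X" using Sc(1) Tc Xc by (simp add: Y_def mat_mult_assoc_dim)
  then have SY: "S * Y = X" using Xc by (simp add: ST)
  note tr = trace[OF Y, unfolded SY]
  obtain K where K: "K \<in> OrSp k" and le: "2 * (\<Sum>j<k. d j) \<le> mat_trace (X\<^sup>T * M * X)"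
    and eq: "mat_trace (X\<^sup>T * M * X) = 2 * (\<Sum>j<k. d j) \<Longrightarrow>
      double_diag n d * (Y * K) = J_mat n * (Y * K) * skew_diag k d"
    using double_diag_trace_minimum[OF Y kn pos mono, folded tr] by blast
  show "2 * (\<Sum>j<k. d j) \<le> mat_trace (X\<^sup>T * M * X)" by fact
  assume "mat_trace (X\<^sup>T * M * X) = 2 * (\<Sum>j<k. d j)"
  note eq = eq[OF this]
  define L where "L = skew_diag k d"
  have L: "dim_row L = 2 * k" "dim_col L = 2 * k" by (simp_all add: L_def mat_diag_def)
  have Kc: "K \<in> carrier_mat (2 * k) (2 * k)" using K by (rule OrSp_mult_transpose)
  have TS: "T\<^sup>T * S\<^sup>T = 1\<^sub>m (2 * n)"
    using transpose_mult[OF Sc(1) Tc] by (simp add: ST)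
  have cancel: "T\<^sup>T * (S\<^sup>T * A) = A" if "A \<in> carrier_mat (2 * n) m" for A m
  proof -
    have "T\<^sup>T * (S\<^sup>T * A) = T\<^sup>T * S\<^sup>T * A" using that Sc(1) Tc by (simp add: mat_mult_assoc_dim)
    then show ?thesis using that by (simp add: TS)
  qed
  \<comment> \<open>The equation for Y K is moved back to X K: writing J as S^T J S exposes a factor
    S^T on both sides, which T^T then cancels.\<close>
  have "S\<^sup>T * (M * (X * K)) = S\<^sup>T * M * S * (Y * K)"
    using Sc(1) M Yc Kc by (simp add: mat_mult_assoc_dim flip: SY)
  also have "\<dots> = S\<^sup>T * J_mat n * S * (Y * K) * L"
    unfolding SMS Sc(2) L_def by (rule eq)
  also have "\<dots> = S\<^sup>T * (J_mat n * (X * K) * L)"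
    using Sc(1) Yc Kc L Jd by (simp add: mat_mult_assoc_dim flip: SY)
  finally have "T\<^sup>T * (S\<^sup>T * (M * (X * K))) = T\<^sup>T * (S\<^sup>T * (J_mat n * (X * K) * L))" by simp
  then have "M * (X * K) = J_mat n * (X * K) * L"
    using M Xc Kc L Jd
    by (subst (asm) (1 2) cancel[of _ "2 * k"]) (auto intro!: carrier_matI)
  moreover have "X * K \<in> Sp k n" using X K by (auto simp: OrSp_def intro: Sp_times_Sp)
  ultimately show "\<exists>K \<in> OrSp k. normalized_symplectic_eigenvector_set n k M d (X * K)"
    using K by (auto simp: normalized_symplectic_eigenvector_set_def L_def)
qed

theorem corollary4p7:
  fixes n k :: nat and M :: "real mat" and d :: "nat \<Rightarrow> real"
  assumes "sym_pos_def_mat (2 * n) M"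
    and "symplectic_eigenvalues n M d"
    and "1 \<le> k" and "k \<le> n"
  shows "{X. is_arg_min (\<lambda>X. mat_trace (transpose_mat X * M * X))
             (\<lambda>X. X \<in> carrier_mat (2 * n) (2 * k) \<and>
                   transpose_mat X * J_mat n * X = J_mat k) X}
       = (\<Union>X1 \<in> {X1. normalized_symplectic_eigenvector_set n k M d X1}.
            {X1 * K | K. K \<in> OrSp k})"
proof -
  let ?c = "2 * (\<Sum>j<k. d j)"
  let ?f = "\<lambda>X. mat_trace (X\<^sup>T * M * X)"
  have M: "M \<in> carrier_mat (2 * n) (2 * n)" using assms(1) by (simp add: sym_pos_def_mat_def)
  note min = symplectic_trace_minimum[OF M assms(2,4)]
  have Sp: "X \<in> Sp k n \<longleftrightarrow> X \<in> carrier_mat (2 * n) (2 * k) \<and> X\<^sup>T * J_mat n * X = J_mat k" for X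
    by (simp add: Sp_def)
  \<comment> \<open>Because the lower bound \<open>?c\<close> is attained, the minimizers are
    exactly the feasible points of value \<open>?c\<close>.\<close>
  have arg_min: "is_arg_min ?f (\<lambda>X. X \<in> Sp k n) X \<longleftrightarrow> X \<in> Sp k n \<and> ?f X = ?c" for X
    using min(1,3) unfolding is_arg_min_def by (metis le_less not_le)
  have "X \<in> Sp k n \<and> ?f X = ?c \<longleftrightarrow>
      (\<exists>X1 K. normalized_symplectic_eigenvector_set n k M d X1 \<and> K \<in> OrSp k \<and> X = X1 * K)" for X
  proof
    assume X: "X \<in> Sp k n \<and> ?f X = ?c"
    then obtain K where K: "K \<in> OrSp k" "normalized_symplectic_eigenvector_set n k M d (X * K)"
      using min(2) by blast
    note K' = OrSp_mult_transpose[OF K(1)]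
    have Xc: "X \<in> carrier_mat (2 * n) (2 * k)" using X by (simp add: Sp)
    \<comment> \<open>The eigenvector set is X K, so X itself lies in its orbit through K^T.\<close>
    then have "X = (X * K) * K\<^sup>T" using K'(1,2) by (simp add: mat_mult_assoc_dim)
    then show "\<exists>X1 K. normalized_symplectic_eigenvector_set n k M d X1 \<and> K \<in> OrSp k \<and> X = X1 * K"
      using K(2) K'(3) by blast
  next
    assume "\<exists>X1 K. normalized_symplectic_eigenvector_set n k M d X1 \<and> K \<in> OrSp k \<and> X = X1 * K"
    then obtain X1 K where X1: "normalized_symplectic_eigenvector_set n k M d X1"
      and K: "K \<in> OrSp k" and X: "X = X1 * K" by blast
    have X1Sp: "X1 \<in> Sp k n" using X1 by (simp add: normalized_symplectic_eigenvector_set_def)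
    have "?f X = ?f X1"
      unfolding X by (rule mat_trace_orthogonal_conj) (use X1Sp M K in \<open>auto simp: Sp\<close>)
    moreover have "X \<in> Sp k n" using X1Sp K by (auto simp: X OrSp_def intro: Sp_times_Sp)
    ultimately show "X \<in> Sp k n \<and> ?f X = ?c"
      using mat_trace_normalized_symplectic_eigenvector_set[OF M X1] by simp
  qed
  then show ?thesis
    unfolding Sp[symmetric] arg_min by blast
qed

end
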